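(* Let $\Omega\subset\mathbb{Z}^2$ be a finite image support with $N$ pixels, and let $\mathbf{K}\in\mathbb{R}^{N\times N}$ be the nonlocal means (NLM) kernel matrix and $\mathbf{D}\in\mathbb{R}^{N\times N}$ the associated diagonal normalization matrix, both computed from a fixed guide image (see context). Then $\mathbf{K}$ is positive definite. Furthermore, the corresponding NLM denoiser $D(x)=\mathbf{D}^{-1}\mathbf{K}x$ on $\mathbb{R}^N$ is the proximal map, on $(\mathbb{R}^N,\langle\cdot,\cdot\rangle)$ with $\langle x,y\rangle=x^\top\mathbf{D}y$, of the convex regularizer $$g_D(x)=\tfrac12\,x^\top\mathbf{D}\,(\mathbf{K}^{-1}\mathbf{D}-\mathbf{I})\,x.$$
   Context: Features: for each pixel $s\in\Omega$, $\mathbf{P}_s\in\mathbb{R}^P$ is a fixed vector (the vectorized patch around $s$ of the guide image), and $\zeta_s=(s,\mathbf{P}_s)\in\mathbb{R}^{2+P}$. NLM kernel: $\phi(\zeta_s,\zeta_t)=\Lambda(s-t)\,\kappa(\mathbf{P}_s-\mathbf{P}_t)$, where $\kappa:\mathbb{R}^P\to\mathbb{R}$ is a (centered) Gaussian function, $\kappa(v)=c\exp(-\tfrac12 v^\top \mathbf{Q}v)$ with $c>0$ and $\mathbf{Q}$ symmetric positive definite, and $\Lambda:\mathbb{R}^2\to\mathbb{R}$ is the hat function $\Lambda(s)=\prod_{i=1}^2\big(1-|s_i/N_s|\big)_+$ with $(t)_+=\max(0,t)$ and search radius $N_s>0$. Matrices: let $\xi_1,\dots,\xi_N$ be an ordering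 of $\{\zeta_s:s\in\Omega\}$; $\mathbf{K}_{i,j}=\phi(\xi_i,\xi_j)$; $\mathbf{D}$ is diagonal with $\mathbf{D}_{i,i}=\sum_{j=1}^N\mathbf{K}_{i,j}$. $\mathbf{I}$ is the identity matrix. "$\mathbf{K}$ positive definite" means symmetric with $c^\top\mathbf{K}c>0$ for all nonzero $c\in\mathbb{R}^N$. Proximal map on $(\mathbb{R}^N,\langle\cdot,\cdot\rangle)$ with induced norm $\|\cdot\|$: $\mathrm{Prox}_g(x)=\arg\min_{y}\ \tfrac12\|y-x\|^2+g(y)$ for closed, proper, convex $g$. *)

theory Defs
  imports "HOL-Analysis.Analysis"
begin

definition pos_def_matrix :: "real ^ 'n ^ 'n \<Rightarrow> bool" where
  "pos_def_matrix A \<longleftrightarrow> transpose A = A \<and> (\<forall>c. c \<noteq> 0 \<longrightarrow> 0 < c \<bullet> (A *v c))"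

definition is_inner_product :: "('a::real_vector \<Rightarrow> 'a \<Rightarrow> real) \<Rightarrow> bool" where
  "is_inner_product ip \<longleftrightarrow>
     (\<forall>y. linear (\<lambda>x. ip x y)) \<and> (\<forall>x y. ip x y = ip y x) \<and> (\<forall>x. x \<noteq> 0 \<longrightarrow> 0 < ip x x)"

definition ip_norm :: "('a \<Rightarrow> 'a \<Rightarrow> real) \<Rightarrow> 'a \<Rightarrow> real" where
  "ip_norm ip x = sqrt (ip x x)"

(* All inner products on a finite-dimensional space induce the same topology, so closedness
   of g below does not refer to the inner product of the proximal map. *)

definition ereal_epigraph :: "('a \<Rightarrow> ereal) \<Rightarrow> ('a \<times> real) set" where
  "ereal_epigraph g = {(x, r). g x \<le> ereal r}"

definition closed_proper_convex :: "('a::euclidean_space \<Rightarrow> ereal) \<Rightarrow> bool" where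
  "closed_proper_convex g \<longleftrightarrow>
     closed (ereal_epigraph g) \<and>
     (\<exists>x. g x < \<infinity>) \<and> (\<forall>x. g x \<noteq> -\<infinity>) \<and>
     convex (ereal_epigraph g)"

definition prox_objective ::
  "('a::euclidean_space \<Rightarrow> 'a \<Rightarrow> real) \<Rightarrow> ('a \<Rightarrow> ereal) \<Rightarrow> 'a \<Rightarrow> 'a \<Rightarrow> ereal" where
  "prox_objective ip g x y = ereal (1/2 * (ip_norm ip (y - x))\<^sup>2) + g y"

(* The proximal map is single-valued, so T = Prox_g means that for every x
   the set of minimizers is exactly {T x}. *)

definition is_proximal_map ::
  "('a::euclidean_space \<Rightarrow> 'a \<Rightarrow> real) \<Rightarrow> ('a \<Rightarrow> ereal) \<Rightarrow> ('a \<Rightarrow> 'a) \<Rightarrow> bool" where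
  "is_proximal_map ip g T \<longleftrightarrow>
     is_inner_product ip \<and> closed_proper_convex g \<and>
     (\<forall>x. {y. is_arg_min (prox_objective ip g x) (\<lambda>_. True) y} = {T x})"

definition hat :: "real \<Rightarrow> real ^ 2 \<Rightarrow> real" where
  "hat Ns s = (\<Prod>i\<in>UNIV. max 0 (1 - \<bar>s $ i / Ns\<bar>))"

definition gaussian :: "real \<Rightarrow> real ^ 'p ^ 'p \<Rightarrow> real ^ 'p \<Rightarrow> real" where
  "gaussian c Q v = c * exp (- (1/2) * (v \<bullet> (Q *v v)))"

definition pixel_pos :: "int ^ 2 \<Rightarrow> real ^ 2" where
  "pixel_pos s = (\<chi> i. real_of_int (s $ i))"

definition feature :: "(int ^ 2 \<Rightarrow> real ^ 'p) \<Rightarrow> int ^ 2 \<Rightarrow> (real ^ 2) \<times> (real ^ 'p)" where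
  "feature patch s = (pixel_pos s, patch s)"

definition nlm_kernel ::
  "real \<Rightarrow> real \<Rightarrow> real ^ 'p ^ 'p \<Rightarrow> (real ^ 2) \<times> (real ^ 'p) \<Rightarrow> (real ^ 2) \<times> (real ^ 'p) \<Rightarrow> real" where
  "nlm_kernel Ns c Q z w = hat Ns (fst z - fst w) * gaussian c Q (snd z - snd w)"

definition kernel_matrix :: "('b \<Rightarrow> 'b \<Rightarrow> real) \<Rightarrow> ('n \<Rightarrow> 'b) \<Rightarrow> real ^ 'n ^ 'n" where
  "kernel_matrix \<phi> \<xi> = (\<chi> i j. \<phi> (\<xi> i) (\<xi> j))"

definition normalization_matrix :: "real ^ 'n ^ 'n \<Rightarrow> real ^ 'n ^ 'n" where
  "normalization_matrix K = (\<chi> i j. if i = j then (\<Sum>k\<in>UNIV. K $ i $ k) else 0)"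

definition denoiser :: "real ^ 'n ^ 'n \<Rightarrow> real ^ 'n ^ 'n \<Rightarrow> real ^ 'n \<Rightarrow> real ^ 'n" where
  "denoiser K D x = (matrix_inv D ** K) *v x"

definition regularizer :: "real ^ 'n ^ 'n \<Rightarrow> real ^ 'n ^ 'n \<Rightarrow> real ^ 'n \<Rightarrow> real" where
  "regularizer K D x = 1/2 * (x \<bullet> ((D ** (matrix_inv K ** D - mat 1)) *v x))"

end

(* The one-dimensional hat is an autocorrelation: N * hat(s - t) is the length of the overlap of
   [s, s + N] and [t, t + N].  Hence the quadratic form of its entrywise product with a positive
   semidefinite M is 1/N times the integral over x of the form of M at the vector
   (c_i 1_[s_i, s_i + N](x))_i.  Just to the right of the smallest s_i with c_i nonzero only the
   indices sharing that smallest position survive, so strict positivity need only be checked on such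
   fibres.  Applying this to both coordinates leaves a single pixel, where the Gaussian has a
   positive diagonal.  The Gaussian itself is positive semidefinite since, up to a rank-one factor,
   it is the entrywise exponential of a Gram matrix.

   For the denoiser, D - K is the Laplacian of a graph with nonnegative weights, so 0 < K <= D and
   thus D K^{-1} D - D >= 0, which is convexity of the regularizer.  Completing the square, the
   proximal objective at y exceeds its value at z = D^{-1} K x by half the form of D K^{-1} D
   at y - z. *)

theory Submission
  imports Defs
begin


section \<open>Positive semidefinite kernels on a finite index type\<close>

definition psd_kernel :: "('n::finite \<Rightarrow> 'n \<Rightarrow> real) \<Rightarrow> bool" where
  "psd_kernel M \<longleftrightarrow> (\<forall>i j. M i j = M j i) \<and> (\<forall>c. 0 \<le> (\<Sum>i\<in>UNIV. \<Sum>j\<in>UNIV. c i * c j * M i j))"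

lemma psd_kernelI:
  "(\<And>i j. M i j = M j i) \<Longrightarrow> (\<And>c. 0 \<le> (\<Sum>i\<in>UNIV. \<Sum>j\<in>UNIV. c i * c j * M i j)) \<Longrightarrow> psd_kernel M"
  by (simp add: psd_kernel_def)

lemma psd_kernel_sym: "psd_kernel M \<Longrightarrow> M i j = M j i"
  by (simp add: psd_kernel_def)

lemma psd_kernel_form: "psd_kernel M \<Longrightarrow> 0 \<le> (\<Sum>i\<in>UNIV. \<Sum>j\<in>UNIV. c i * c j * M i j)"
  by (simp add: psd_kernel_def)

text \<open>Perturbing one coordinate is the only variation of \<open>c\<close> used below.
  Instances with \<open>c = 0\<close> evaluate the form at a multiple of a unit vector; they write
  \<open>0 + ...\<close> so that the left-hand side matches syntactically.\<close>

lemma quadratic_form_add_delta: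
  fixes M :: "'n::finite \<Rightarrow> 'n \<Rightarrow> real"
  shows "(\<Sum>i\<in>UNIV. \<Sum>j\<in>UNIV. (c i + (if i = k then t else 0)) * (c j + (if j = k then t else 0)) * M i j)
    = (\<Sum>i\<in>UNIV. \<Sum>j\<in>UNIV. c i * c j * M i j)
      + t * (\<Sum>i\<in>UNIV. c i * M i k) + t * (\<Sum>j\<in>UNIV. c j * M k j) + t\<^sup>2 * M k k"
proof -
  have "(c i + (if i = k then t else 0)) * (c j + (if j = k then t else 0)) * M i j
     = c i * c j * M i j + (if j = k then t * (c i * M i j) else 0) + (if i = k then t * (c j * M i j) else 0)
       + (if j = k then (if i = k then t\<^sup>2 * M i j else 0) else 0)" for i j
    by (auto simp: algebra_simps power2_eq_square)
  moreover have "(\<Sum>i\<in>UNIV. \<Sum>j\<in>UNIV. if i = k then t * (c j * M i j) else 0) = t * (\<Sum>j\<in>UNIV. c j * M k j)"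
    by (subst sum.swap) (simp add: sum_distrib_left)
  ultimately show ?thesis
    by (simp add: sum.distrib sum_distrib_left)
qed

lemma psd_kernel_diag_nonneg:
  assumes "psd_kernel M"
  shows "0 \<le> M k k"
  using psd_kernel_form[OF assms, of "\<lambda>i. 0 + (if i = k then 1 else 0)"]
  unfolding quadratic_form_add_delta by simp

text \<open>For fixed \<open>c\<close> this is a polynomial in \<open>t\<close> of degree at most
  two. Suitable values of \<open>t\<close> give both the vanishing of columns with zero diagonal and
  the Schur complement.\<close>

lemma psd_kernel_form_shift:
  assumes M: "psd_kernel M"
  shows "0 \<le> (\<Sum>i\<in>UNIV. \<Sum>j\<in>UNIV. c i * c j * M i j) + 2 * t * (\<Sum>i\<in>UNIV. c i * M i k) + t\<^sup>2 * M k k"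
proof -
  have "(\<Sum>j\<in>UNIV. c j * M k j) = (\<Sum>j\<in>UNIV. c j * M j k)"
    by (subst psd_kernel_sym[OF M]) (rule refl)
  then show ?thesis
    using psd_kernel_form[OF M, of "\<lambda>i. c i + (if i = k then t else 0)"]
    unfolding quadratic_form_add_delta by simp
qed

lemma psd_kernel_zero_diag:
  assumes M: "psd_kernel M" and k: "M k k = 0"
  shows "M i k = 0"
proof (rule ccontr)
  assume nz: "M i k \<noteq> 0"
  \<comment> \<open>With \<open>M k k = 0\<close> the form at e_i + t e_k is affine in
    \<open>t\<close> with slope 2 M i k. A nonzero slope makes it unbounded below, and this
    \<open>t\<close> gives it the value -1.\<close>
  define t where "t = - (M i i + 1) / (2 * M i k)"
  have "0 \<le> M i i + 2 * t * M i k"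
    using psd_kernel_form_shift[OF M, of "\<lambda>j. 0 + (if j = i then 1 else 0)" t k] k
    unfolding quadratic_form_add_delta by (simp add: if_distrib[of "\<lambda>x. x * _"] cong: if_cong)
  also have "\<dots> = -1" using nz by (simp add: t_def field_simps)
  finally show False by simp
qed

section \<open>Schur complements and entrywise products\<close>

lemma psd_kernel_schur_complement:
  assumes M: "psd_kernel M" and k: "M k k > 0"
  shows "psd_kernel (\<lambda>i j. M i j - M i k * M j k / M k k)"
  unfolding psd_kernel_def
proof (intro conjI allI)
  fix i j show "M i j - M i k * M j k / M k k = M j i - M j k * M i k / M k k"
    by (subst psd_kernel_sym[OF M, of i j]) simp
next
  fix c :: "'a \<Rightarrow> real"
  let ?s = "\<Sum>i\<in>UNIV. c i * M i k"
  have "(\<Sum>i\<in>UNIV. \<Sum>j\<in>UNIV. c i * c j * (M i j - M i k * M j k / M k k))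
      = (\<Sum>i\<in>UNIV. \<Sum>j\<in>UNIV. c i * c j * M i j) - (\<Sum>i\<in>UNIV. \<Sum>j\<in>UNIV. (c i * M i k) * (c j * M j k)) / M k k"
    by (simp add: sum_divide_distrib sum_subtractf[symmetric] algebra_simps)
  also have "(\<Sum>i\<in>UNIV. \<Sum>j\<in>UNIV. (c i * M i k) * (c j * M j k)) = ?s * ?s"
    by (simp add: sum_product)
  finally have "(\<Sum>i\<in>UNIV. \<Sum>j\<in>UNIV. c i * c j * (M i j - M i k * M j k / M k k))
      = (\<Sum>i\<in>UNIV. \<Sum>j\<in>UNIV. c i * c j * M i j) - ?s * ?s / M k k" .
  moreover have "0 \<le> (\<Sum>i\<in>UNIV. \<Sum>j\<in>UNIV. c i * c j * M i j) - ?s * ?s / M k k"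
    \<comment> \<open>This \<open>t\<close> minimizes the quadratic polynomial of
      \<open>psd_kernel_form_shift\<close>, and the minimum is the form of the Schur
      complement.\<close>
    using psd_kernel_form_shift[OF M, of c "- ?s / M k k" k] k
    by (simp add: power2_eq_square)
  ultimately show "0 \<le> (\<Sum>i\<in>UNIV. \<Sum>j\<in>UNIV. c i * c j * (M i j - M i k * M j k / M k k))" by simp
qed

(* Schur product theorem by elimination: splitting A into its Schur complement at k and a rank-one
   kernel removes k from the support S and avoids any spectral decomposition. *)
lemma psd_kernel_mult_supported:
  fixes A B :: "'n::finite \<Rightarrow> 'n \<Rightarrow> real"
  assumes "finite S" "psd_kernel A" "psd_kernel B" "\<And>i j. i \<notin> S \<Longrightarrow> A i j = 0"
  shows "0 \<le> (\<Sum>i\<in>UNIV. \<Sum>j\<in>UNIV. c i * c j * (A i j * B i j))"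
  using assms
proof (induction S arbitrary: A rule: finite_induct)
  case empty
  then show ?case by simp
next
  case (insert k S)
  show ?case
  proof (cases "A k k = 0")
    case True
    \<comment> \<open>A zero diagonal entry forces the whole row \<open>k\<close> to vanish, so
      \<open>S\<close> alone already supports \<open>A\<close>.\<close>
    have "A i j = 0" if "i \<notin> S" for i j
      using that insert.prems psd_kernel_zero_diag[OF insert.prems(1) True, of j]
        psd_kernel_sym[OF insert.prems(1), of k j] by (cases "i = k") auto
    then show ?thesis using insert by blast
  next
    case False
    then have pos: "A k k > 0" using psd_kernel_diag_nonneg[OF insert.prems(1), of k] by simp
    define A' where "A' = (\<lambda>i j. A i j - A i k * A j k / A k k)"
    have "A' i j = 0" if "i \<notin> S" for i j
      using that insert.prems(3)[of i] pos psd_kernel_sym[OF insert.prems(1), of k j]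
      unfolding A'_def by (cases "i = k") auto
    moreover have "psd_kernel A'"
      unfolding A'_def by (rule psd_kernel_schur_complement[OF insert.prems(1) pos])
    ultimately have "0 \<le> (\<Sum>i\<in>UNIV. \<Sum>j\<in>UNIV. c i * c j * (A' i j * B i j))"
      using insert by blast
    \<comment> \<open>The rank-one part of \<open>A\<close> is absorbed into the vector: its
      entrywise product with \<open>B\<close> has the form of \<open>B\<close> at c_i A i k, divided
      by \<open>A k k\<close>.\<close>
    moreover have "0 \<le> (\<Sum>i\<in>UNIV. \<Sum>j\<in>UNIV. (c i * A i k) * (c j * A j k) * B i j) / A k k"
      using psd_kernel_form[OF insert.prems(2), of "\<lambda>i. c i * A i k"] pos by simp
    moreover have "(\<Sum>i\<in>UNIV. \<Sum>j\<in>UNIV. c i * c j * (A i j * B i j))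
       = (\<Sum>i\<in>UNIV. \<Sum>j\<in>UNIV. c i * c j * (A' i j * B i j))
         + (\<Sum>i\<in>UNIV. \<Sum>j\<in>UNIV. (c i * A i k) * (c j * A j k) * B i j) / A k k"
      using pos unfolding A'_def
      by (simp add: sum_divide_distrib sum.distrib[symmetric] field_simps)
    ultimately show ?thesis by simp
  qed
qed

lemma psd_kernel_mult:
  assumes "psd_kernel A" "psd_kernel B"
  shows "psd_kernel (\<lambda>i j. A i j * B i j)"
proof (rule psd_kernelI)
  show "A i j * B i j = A j i * B j i" for i j
    by (rule arg_cong2[OF psd_kernel_sym[OF assms(1)] psd_kernel_sym[OF assms(2)]])
  show "0 \<le> (\<Sum>i\<in>UNIV. \<Sum>j\<in>UNIV. c i * c j * (A i j * B i j))" for c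
    by (rule psd_kernel_mult_supported[OF finite[of UNIV] assms]) simp
qed

lemma psd_kernel_rank_one: "psd_kernel (\<lambda>i j. f i * f j)"
proof -
  have "(\<Sum>i\<in>UNIV. \<Sum>j\<in>UNIV. c i * c j * (f i * f j)) = (\<Sum>i\<in>UNIV. c i * f i) * (\<Sum>i\<in>UNIV. c i * f i)" for c
    unfolding sum_product by (intro sum.cong refl) (simp only: mult_ac)
  then show ?thesis by (intro psd_kernelI) (simp_all add: mult.commute)
qed

section \<open>Entrywise powers, exponentials and the Gaussian\<close>

lemma psd_kernel_power:
  assumes "psd_kernel A"
  shows "psd_kernel (\<lambda>i j. A i j ^ n)"
proof (induction n)
  case 0
  show ?case using psd_kernel_rank_one[of "\<lambda>_. 1"] by simp
next
  case (Suc n)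
  show ?case using psd_kernel_mult[OF assms Suc.IH] by simp
qed

text \<open>The exponential series has nonnegative coefficients, so the form is the sum of a series
  whose terms are nonnegative multiples of forms of entrywise powers.\<close>

lemma psd_kernel_exp:
  assumes A: "psd_kernel A"
  shows "psd_kernel (\<lambda>i j. exp (A i j))"
proof -
  have "0 \<le> (\<Sum>i\<in>UNIV. \<Sum>j\<in>UNIV. c i * c j * exp (A i j))" for c
  proof -
    let ?p = "\<lambda>n. \<Sum>i\<in>UNIV. \<Sum>j\<in>UNIV. c i * c j * (A i j ^ n /\<^sub>R fact n)"
    have p: "?p sums (\<Sum>i\<in>UNIV. \<Sum>j\<in>UNIV. c i * c j * exp (A i j))"
      by (rule sums_sum, rule sums_sum, rule sums_mult, rule exp_converges)
    have nn: "0 \<le> ?p n" for n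
    proof -
      have "?p n = (\<Sum>i\<in>UNIV. \<Sum>j\<in>UNIV. c i * c j * A i j ^ n) /\<^sub>R fact n"
        unfolding scaleR_sum_right by (intro sum.cong refl) simp
      also have "0 \<le> \<dots>"
        by (rule scaleR_nonneg_nonneg[OF _ psd_kernel_form[OF psd_kernel_power[OF A]]]) simp
      finally show ?thesis .
    qed
    show ?thesis by (rule sums_le[OF nn sums_zero p])
  qed
  then show ?thesis by (intro psd_kernelI arg_cong[OF psd_kernel_sym[OF A]])
qed

lemma pos_def_matrix_inner_commute:
  assumes "pos_def_matrix A"
  shows "x \<bullet> (A *v y) = y \<bullet> (A *v x)"
  using assms unfolding pos_def_matrix_def
  by (metis dot_lmul_matrix inner_commute transpose_matrix_vector)

lemma pos_def_matrix_nonneg: "pos_def_matrix A \<Longrightarrow> 0 \<le> x \<bullet> (A *v x)"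
  unfolding pos_def_matrix_def by (cases "x = 0") (auto intro: less_imp_le)

lemma psd_kernel_gram:
  fixes v :: "'n::finite \<Rightarrow> real ^ 'p"
  assumes Q: "pos_def_matrix Q"
  shows "psd_kernel (\<lambda>i j. v i \<bullet> (Q *v v j))"
proof -
  have "(\<Sum>i\<in>UNIV. \<Sum>j\<in>UNIV. c i * c j * (v i \<bullet> (Q *v v j))) =
     (\<Sum>i\<in>UNIV. c i *\<^sub>R v i) \<bullet> (Q *v (\<Sum>j\<in>UNIV. c j *\<^sub>R v j))" for c
    by (subst sum.swap) (simp add: linear_sum[OF matrix_vector_mul_linear] inner_sum_left inner_sum_right
        matrix_vector_mult_scaleR sum_distrib_left mult_ac)
  then show ?thesis
    by (intro psd_kernelI pos_def_matrix_inner_commute[OF Q]) (simp only: pos_def_matrix_nonneg[OF Q])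
qed

lemma psd_kernel_gaussian:
  fixes v :: "'n::finite \<Rightarrow> real ^ 'p"
  assumes Q: "pos_def_matrix Q" and c: "c > 0"
  shows "psd_kernel (\<lambda>i j. gaussian c Q (v i - v j))"
proof -
  \<comment> \<open>Expanding the square in the exponent isolates the Gram entry of v_i and v_j. The
    remaining terms depend on one index each, and splitting \<open>c\<close> into two square roots
    makes them a rank-one kernel.\<close>
  define f where "f i = sqrt c * exp (- (1/2) * (v i \<bullet> (Q *v v i)))" for i
  have "gaussian c Q (v i - v j) = (f i * f j) * exp (v i \<bullet> (Q *v v j))" for i j
  proof -
    have "(v i - v j) \<bullet> (Q *v (v i - v j)) = v i \<bullet> (Q *v v i) + v j \<bullet> (Q *v v j) - 2 * (v i \<bullet> (Q *v v j))"
      by (simp add: inner_diff_left inner_diff_right matrix_vector_mult_diff_distrib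
          psd_kernel_sym[OF psd_kernel_gram[OF Q, of v], of j i])
    then have "- (1/2) * ((v i - v j) \<bullet> (Q *v (v i - v j))) =
      - (1/2) * (v i \<bullet> (Q *v v i)) + - (1/2) * (v j \<bullet> (Q *v v j)) + v i \<bullet> (Q *v v j)"
      by (simp add: algebra_simps)
    then show ?thesis using c
      unfolding gaussian_def f_def by (simp only: exp_add) simp
  qed
  then show ?thesis
    using psd_kernel_mult[OF psd_kernel_rank_one[of f] psd_kernel_exp[OF psd_kernel_gram[OF Q, of v]]]
    by simp
qed

section \<open>The hat function as an overlap integral\<close>

lemma has_integral_indicator_overlap:
  fixes a b N :: real
  assumes "N \<ge> 0"
  shows "((\<lambda>x. indicat_real {a..a+N} x * indicat_real {b..b+N} x) has_integral max 0 (N - \<bar>a - b\<bar>)) UNIV"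
proof -
  have "{a..a+N} \<inter> {b..b+N} = {max a b..min a b + N}" by auto
  then have "(\<lambda>x. indicat_real {a..a+N} x * indicat_real {b..b+N} x)
      = (\<lambda>x. if x \<in> {max a b..min a b + N} then 1 else 0)"
    by (auto simp: indicator_def fun_eq_iff)
  moreover have "((\<lambda>_. 1) has_integral max 0 (N - \<bar>a - b\<bar>)) {max a b..min a b + N}"
  proof (cases "max a b \<le> min a b + N")
    case True
    then have "max 0 (N - \<bar>a - b\<bar>) = min a b + N - max a b" by auto
    with True show ?thesis
      using has_integral_const_real[of "1::real" "max a b" "min a b + N"] by (simp del: max.absorb1)
  next
    case False
    then have "{max a b..min a b + N} = {}" "max 0 (N - \<bar>a - b\<bar>) = 0" by auto
    then show ?thesis by simp
  qed
  ultimately show ?thesis by (simp only: has_integral_restrict_UNIV)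
qed

definition hat1 :: "real \<Rightarrow> real \<Rightarrow> real" where
  "hat1 N y = max 0 (1 - \<bar>y / N\<bar>)"

lemma hat_eq_hat1: "hat N s = hat1 N (s $ 1) * hat1 N (s $ 2)"
  by (simp add: hat_def hat1_def UNIV_2)

lemma hat1_nonneg: "0 \<le> hat1 N y"
  by (simp add: hat1_def)

lemma has_integral_hat1_form:
  fixes a :: "'n::finite \<Rightarrow> real"
  assumes N: "N > 0"
  defines "ind \<equiv> \<lambda>i. indicat_real {a i..a i + N}"
  shows "((\<lambda>x. \<Sum>i\<in>UNIV. \<Sum>j\<in>UNIV. (c i * ind i x) * (c j * ind j x) * M i j) has_integral
      N * (\<Sum>i\<in>UNIV. \<Sum>j\<in>UNIV. c i * c j * (hat1 N (a i - a j) * M i j))) UNIV"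
proof -
  \<comment> \<open>The overlap length has height \<open>N\<close> at the origin, which accounts for
    the factor \<open>N\<close> in front of the form.\<close>
  have hat: "max 0 (N - \<bar>y\<bar>) = N * hat1 N y" for y
    using N by (simp add: hat1_def max_def field_simps)
  have "((\<lambda>x. \<Sum>i\<in>UNIV. \<Sum>j\<in>UNIV. c i * c j * M i j * (ind i x * ind j x)) has_integral
      (\<Sum>i\<in>UNIV. \<Sum>j\<in>UNIV. c i * c j * M i j * max 0 (N - \<bar>a i - a j\<bar>))) UNIV"
    unfolding ind_def
    by (intro has_integral_sum has_integral_mult_right has_integral_indicator_overlap finite less_imp_le N)
  moreover have "(\<Sum>i\<in>UNIV. \<Sum>j\<in>UNIV. c i * c j * M i j * max 0 (N - \<bar>a i - a j\<bar>))
      = N * (\<Sum>i\<in>UNIV. \<Sum>j\<in>UNIV. c i * c j * (hat1 N (a i - a j) * M i j))"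
    unfolding hat sum_distrib_left by (intro sum.cong refl) (simp only: mult_ac)
  moreover have "(\<lambda>x. \<Sum>i\<in>UNIV. \<Sum>j\<in>UNIV. c i * c j * M i j * (ind i x * ind j x))
      = (\<lambda>x. \<Sum>i\<in>UNIV. \<Sum>j\<in>UNIV. (c i * ind i x) * (c j * ind j x) * M i j)"
    by (intro ext sum.cong refl) (simp only: mult_ac)
  ultimately show ?thesis by (simp only:)
qed

lemma psd_kernel_hat1_mult:
  assumes N: "N > 0" and M: "psd_kernel M"
  shows "psd_kernel (\<lambda>i j. hat1 N (a i - a j) * M i j)"
proof (rule psd_kernelI)
  show "hat1 N (a i - a j) * M i j = hat1 N (a j - a i) * M j i" for i j
    by (subst psd_kernel_sym[OF M, of i j]) (simp add: hat1_def abs_minus_commute[of "a i" "a j"])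
  show "0 \<le> (\<Sum>i\<in>UNIV. \<Sum>j\<in>UNIV. c i * c j * (hat1 N (a i - a j) * M i j))" for c
  proof -
    have "0 \<le> N * (\<Sum>i\<in>UNIV. \<Sum>j\<in>UNIV. c i * c j * (hat1 N (a i - a j) * M i j))"
      by (rule has_integral_nonneg[OF has_integral_hat1_form[OF N] psd_kernel_form[OF M]])
    with N show ?thesis by (simp add: zero_le_mult_iff)
  qed
qed

text \<open>The hypothesis \<open>fibre\<close> ranges over all nonzero vectors supported on one
  fibre of \<open>a\<close> within the support of \<open>c\<close>. It has the shape of the
  conclusion, so the lemma can be applied to a second coordinate inside the first.\<close>

lemma hat1_form_pos:
  fixes a c :: "'n::finite \<Rightarrow> real"
  assumes N: "N > 0" and M: "psd_kernel M" and c: "c k \<noteq> 0"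
    and fibre: "\<And>\<alpha> d l. d l \<noteq> 0 \<Longrightarrow> (\<And>i. d i \<noteq> 0 \<Longrightarrow> c i \<noteq> 0 \<and> a i = \<alpha>) \<Longrightarrow>
      0 < (\<Sum>i\<in>UNIV. \<Sum>j\<in>UNIV. d i * d j * M i j)"
  shows "0 < (\<Sum>i\<in>UNIV. \<Sum>j\<in>UNIV. c i * c j * (hat1 N (a i - a j) * M i j))"
proof -
  define S where "S = {i. c i \<noteq> 0}"
  define m where "m = Min (a ` S)"
  \<comment> \<open>\<open>u\<close> is the next occupied position after \<open>m\<close>, capped at
    m + N. On [m, w], with \<open>w\<close> strictly below \<open>u\<close>, every interval starting
    at \<open>m\<close> is still active and no other interval from the support has begun.\<close>
  define u where "u = Min (insert (m + N) {x \<in> a ` S. m < x})"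
  define w where "w = (m + u) / 2"
  define d where "d i = (if a i = m then c i else 0)" for i
  define F where "F = (\<Sum>i\<in>UNIV. \<Sum>j\<in>UNIV. d i * d j * M i j)"
  let ?ind = "\<lambda>i. indicat_real {a i..a i + N}"
  let ?f = "\<lambda>x. \<Sum>i\<in>UNIV. \<Sum>j\<in>UNIV. (c i * ?ind i x) * (c j * ?ind j x) * M i j"
  have "a ` S \<noteq> {}" using c by (auto simp: S_def)
  then have "m \<in> a ` S" unfolding m_def by (intro Min_in) auto
  then obtain l where l: "l \<in> S" "a l = m" by auto
  have m_le: "m \<le> a i" if "i \<in> S" for i
    using that unfolding m_def by (intro Min_le) auto
  have "m < u" unfolding u_def using N by (subst Min_gr_iff) auto
  moreover have "u \<le> m + N" unfolding u_def by (intro Min_le) auto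
  ultimately have w: "m < w" "w < u" "w \<le> m + N" unfolding w_def by auto
  have above: "w < a i" if "i \<in> S" "a i \<noteq> m" for i
  proof -
    have "u \<le> a i" unfolding u_def using that m_le[of i] by (intro Min_le) auto
    with w show ?thesis by simp
  qed
  have F: "0 < F"
    unfolding F_def
  proof (rule fibre)
    show "d l \<noteq> 0" using l by (simp add: d_def S_def)
    show "c i \<noteq> 0 \<and> a i = m" if "d i \<noteq> 0" for i
      using that by (simp add: d_def split: if_splits)
  qed
  have near_min: "c i * ?ind i x = d i" if "x \<in> {m..w}" for i x
  proof (cases "c i = 0")
    case False
    then have "i \<in> S" by (simp add: S_def)
    with above[of i] that w show ?thesis by (auto simp: d_def indicator_def)
  qed (simp add: d_def)
  have "((\<lambda>x. F) has_integral (w - m) * F) {m..w}"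
    using has_integral_const_real[of F m w] w by simp
  then have int_F: "((\<lambda>x. if x \<in> {m..w} then F else 0) has_integral (w - m) * F) UNIV"
    by (simp only: has_integral_restrict_UNIV)
  \<comment> \<open>The integrand equals \<open>F\<close> on [m, w] and is nonnegative elsewhere
    because \<open>M\<close> is semidefinite.\<close>
  have "(w - m) * F \<le> N * (\<Sum>i\<in>UNIV. \<Sum>j\<in>UNIV. c i * c j * (hat1 N (a i - a j) * M i j))"
  proof (rule has_integral_le[OF int_F has_integral_hat1_form[OF N]])
    fix x
    show "(if x \<in> {m..w} then F else 0) \<le> ?f x"
    proof (cases "x \<in> {m..w}")
      case True
      then have "?f x = F" unfolding F_def by (simp only: near_min)
      with True show ?thesis by simp
    next
      case False
      have "0 \<le> ?f x" by (rule psd_kernel_form[OF M])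
      with False show ?thesis by (simp only: if_False)
    qed
  qed
  moreover have "0 < (w - m) * F" using w F by simp
  ultimately have "0 < N * (\<Sum>i\<in>UNIV. \<Sum>j\<in>UNIV. c i * c j * (hat1 N (a i - a j) * M i j))" by linarith
  with N show ?thesis by (simp add: zero_less_mult_iff)
qed

lemma hat1_hat1_form_pos:
  fixes a b c :: "'n::finite \<Rightarrow> real"
  assumes N: "N > 0" and M: "psd_kernel M" and diag: "\<And>i. 0 < M i i"
    and inj: "\<And>i j. a i = a j \<Longrightarrow> b i = b j \<Longrightarrow> i = j"
    and c: "c k \<noteq> 0"
  shows "0 < (\<Sum>i\<in>UNIV. \<Sum>j\<in>UNIV. c i * c j * (hat1 N (a i - a j) * (hat1 N (b i - b j) * M i j)))"
proof (rule hat1_form_pos[where a = a and c = c and k = k, OF N psd_kernel_hat1_mult[where a = b, OF N M] c])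
  fix \<alpha> l and d :: "'n \<Rightarrow> real"
  assume l: "d l \<noteq> 0" and d: "\<And>i. d i \<noteq> 0 \<Longrightarrow> c i \<noteq> 0 \<and> a i = \<alpha>"
  show "0 < (\<Sum>i\<in>UNIV. \<Sum>j\<in>UNIV. d i * d j * (hat1 N (b i - b j) * M i j))"
  proof (rule hat1_form_pos[where a = b and c = d and k = l, OF N M l])
    fix \<beta> k' and e :: "'n \<Rightarrow> real"
    assume k': "e k' \<noteq> 0" and e: "\<And>i. e i \<noteq> 0 \<Longrightarrow> d i \<noteq> 0 \<and> b i = \<beta>"
    \<comment> \<open>Both coordinates are constant on the support of \<open>e\<close>, so
      separation of the indices leaves a single one.\<close>
    have "e i = 0" if "i \<noteq> k'" for i
    proof (rule ccontr)
      assume "e i \<noteq> 0"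
      then have "a i = a k'" "b i = b k'"
        using d e k' by metis+
      then show False using inj that by blast
    qed
    then have single: "e = (\<lambda>i. 0 + (if i = k' then e k' else 0))"
      by (auto simp: fun_eq_iff)
    \<comment> \<open>Congruence replaces rewriting here: \<open>e\<close> occurs on the right of
      \<open>single\<close>, so using it as a rewrite rule would loop.\<close>
    have "(\<Sum>i\<in>UNIV. \<Sum>j\<in>UNIV. e i * e j * M i j)
        = (\<Sum>i\<in>UNIV. \<Sum>j\<in>UNIV. (0 + (if i = k' then e k' else 0)) * (0 + (if j = k' then e k' else 0)) * M i j)"
      by (rule arg_cong[OF single, of "\<lambda>e. \<Sum>i\<in>UNIV. \<Sum>j\<in>UNIV. e i * e j * M i j"])
    also have "\<dots> = (e k')\<^sup>2 * M k' k'"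
      unfolding quadratic_form_add_delta by simp
    finally show "0 < (\<Sum>i\<in>UNIV. \<Sum>j\<in>UNIV. e i * e j * M i j)" using k' diag[of k'] by simp
  qed
qed

text \<open>The two hats separate distinct positions; the Gaussian contributes semidefiniteness and
  a positive diagonal. Distinct pixels may carry equal patches, hence injectivity is asked of the
  positions.\<close>

lemma pos_def_matrix_nlm_kernel:
  fixes \<xi> :: "'n::finite \<Rightarrow> (real ^ 2) \<times> (real ^ 'p)"
  assumes N: "N > 0" and c: "c > 0" and Q: "pos_def_matrix Q" and inj: "inj (fst \<circ> \<xi>)"
  shows "pos_def_matrix (kernel_matrix (nlm_kernel N c Q) \<xi>)"
proof -
  define M where "M i j = gaussian c Q (snd (\<xi> i) - snd (\<xi> j))" for i j
  let ?a = "\<lambda>i. fst (\<xi> i) $ 1" and ?b = "\<lambda>i. fst (\<xi> i) $ 2"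
  let ?K = "\<lambda>i j. hat1 N (?a i - ?a j) * (hat1 N (?b i - ?b j) * M i j)"
  have M: "psd_kernel M"
    unfolding M_def by (rule psd_kernel_gaussian[OF Q c])
  have K: "kernel_matrix (nlm_kernel N c Q) \<xi> = (\<chi> i j. ?K i j)"
    by (simp add: kernel_matrix_def nlm_kernel_def hat_eq_hat1 M_def mult.assoc)
  have psd: "psd_kernel ?K"
    by (intro psd_kernel_hat1_mult N M)
  have diag: "0 < M i i" for i
    using c by (simp add: M_def gaussian_def)
  have sep: "i = j" if "?a i = ?a j" "?b i = ?b j" for i j
    using injD[OF inj, of i j] that by (simp add: vec_eq_iff forall_2)
  have "0 < x \<bullet> ((\<chi> i j. ?K i j) *v x)" if x: "x \<noteq> 0" for x :: "real ^ 'n"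
  proof -
    obtain k where k: "x $ k \<noteq> 0" using x by (auto simp: vec_eq_iff)
    have "x \<bullet> ((\<chi> i j. ?K i j) *v x) = (\<Sum>i\<in>UNIV. \<Sum>j\<in>UNIV. x $ i * x $ j * ?K i j)"
      unfolding inner_vec_def matrix_vector_mult_def
      by (simp add: sum_distrib_left mult_ac)
    also have "0 < \<dots>"
      by (rule hat1_hat1_form_pos[where c = "\<lambda>i. x $ i" and k = k, OF N M diag sep k])
    finally show ?thesis .
  qed
  moreover have "transpose (\<chi> i j. ?K i j) = (\<chi> i j. ?K i j)"
    unfolding transpose_def vec_eq_iff by (auto intro: psd_kernel_sym[OF psd])
  ultimately show ?thesis unfolding pos_def_matrix_def K by blast
qed

section \<open>Inverse matrices and convexity of the regularizer\<close>

lemma pos_def_matrix_invertible: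
  assumes "pos_def_matrix A"
  shows "invertible A"
proof -
  have "x = 0" if "A *v x = 0" for x
    using assms that unfolding pos_def_matrix_def by (metis inner_zero_right less_irrefl)
  then show ?thesis
    by (simp add: invertible_left_inverse matrix_left_invertible_ker)
qed

lemma matrix_inv_vector_mult:
  fixes A :: "real ^ 'n ^ 'n"
  assumes "invertible A"
  shows "A *v (matrix_inv A *v x) = x" "matrix_inv A *v (A *v x) = x"
proof -
  have "A ** matrix_inv A = mat 1 \<and> matrix_inv A ** A = mat 1"
    using assms unfolding invertible_def matrix_inv_def by (rule someI_ex)
  then show "A *v (matrix_inv A *v x) = x" "matrix_inv A *v (A *v x) = x"
    by (simp_all add: matrix_vector_mul_assoc)
qed

text \<open>The convexity gap between x and y equals (1 - t) t times the form at x - y.\<close>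

lemma convex_on_quadratic_form:
  fixes A :: "real ^ 'n ^ 'n"
  assumes "\<And>x. 0 \<le> x \<bullet> (A *v x)"
  shows "convex_on UNIV (\<lambda>x. x \<bullet> (A *v x))"
proof (rule convex_onI)
  fix t :: real and x y :: "real ^ 'n"
  assume t: "0 < t" "t < 1"
  have "(1 - t) * (x \<bullet> (A *v x)) + t * (y \<bullet> (A *v y))
      - ((1 - t) *\<^sub>R x + t *\<^sub>R y) \<bullet> (A *v ((1 - t) *\<^sub>R x + t *\<^sub>R y))
      = (1 - t) * t * ((x - y) \<bullet> (A *v (x - y)))"
    by (simp add: matrix_vector_right_distrib matrix_vector_mult_diff_distrib matrix_vector_mult_scaleR
        inner_add_left inner_add_right inner_diff_left inner_diff_right algebra_simps)
  moreover have "0 \<le> (1 - t) * t * ((x - y) \<bullet> (A *v (x - y)))"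
    using t assms by simp
  ultimately show "((1 - t) *\<^sub>R x + t *\<^sub>R y) \<bullet> (A *v ((1 - t) *\<^sub>R x + t *\<^sub>R y))
      \<le> (1 - t) * (x \<bullet> (A *v x)) + t * (y \<bullet> (A *v y))"
    by linarith
qed simp

text \<open>With y = K^{-1} D x the form is y.Ky - x.Dx. Expanding 0 <= (y - x).K(y - x) and using K
  y = D x bounds it below by x.Dx - x.Kx, so no order reversal for inverses is invoked.\<close>

lemma regularizer_form_nonneg:
  assumes K: "pos_def_matrix K" and D: "pos_def_matrix D"
    and le: "\<And>x. x \<bullet> (K *v x) \<le> x \<bullet> (D *v x)"
  shows "0 \<le> x \<bullet> ((D ** (matrix_inv K ** D - mat 1)) *v x)"
proof -
  define y where "y = matrix_inv K *v (D *v x)"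
  have Ky: "K *v y = D *v x"
    unfolding y_def by (rule matrix_inv_vector_mult[OF pos_def_matrix_invertible[OF K]])
  have "(D ** (matrix_inv K ** D - mat 1)) *v x = D *v (y - x)"
    by (simp add: y_def matrix_vector_mul_assoc[symmetric] matrix_vector_mult_diff_rdistrib)
  then have "x \<bullet> ((D ** (matrix_inv K ** D - mat 1)) *v x) = y \<bullet> (K *v y) - x \<bullet> (D *v x)"
    by (simp add: matrix_vector_mult_diff_distrib inner_diff_right pos_def_matrix_inner_commute[OF D, of x y] Ky)
  moreover have "0 \<le> (y - x) \<bullet> (K *v (y - x))"
    by (rule pos_def_matrix_nonneg[OF K])
  moreover have "(y - x) \<bullet> (K *v (y - x)) = y \<bullet> (K *v y) - 2 * (x \<bullet> (D *v x)) + x \<bullet> (K *v x)"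
    using pos_def_matrix_inner_commute[OF K, of y x] Ky
    by (simp add: matrix_vector_mult_diff_distrib inner_diff_left inner_diff_right)
  ultimately show ?thesis using le[of x] by linarith
qed

lemma convex_on_regularizer:
  assumes "pos_def_matrix K" "pos_def_matrix D" "\<And>x. x \<bullet> (K *v x) \<le> x \<bullet> (D *v x)"
  shows "convex_on UNIV (regularizer K D)"
  using convex_on_cmul[OF _ convex_on_quadratic_form[OF regularizer_form_nonneg[OF assms]], of "1/2"]
  unfolding regularizer_def by simp

text \<open>A finite convex function on a Euclidean space is continuous, so its epigraph is
  closed.\<close>

lemma closed_proper_convex_real:
  fixes f :: "'a::euclidean_space \<Rightarrow> real"
  assumes conv: "convex_on UNIV f"
  shows "closed_proper_convex (\<lambda>x. ereal (f x))"
proof -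
  have epi: "ereal_epigraph (\<lambda>x. ereal (f x)) = {z. f (fst z) \<le> snd z}"
    by (auto simp: ereal_epigraph_def)
  have "continuous_on UNIV (\<lambda>z :: 'a \<times> real. f (fst z))"
    by (rule continuous_on_compose2[OF convex_on_continuous[OF open_UNIV conv]])
      (simp_all add: continuous_on_fst continuous_on_id)
  then have "closed {z :: 'a \<times> real. f (fst z) \<le> snd z}"
    by (rule closed_Collect_le) (simp add: continuous_on_snd continuous_on_id)
  moreover have "convex {z :: 'a \<times> real. f (fst z) \<le> snd z}"
    using convex_epigraphI[OF conv] by (simp add: epigraph_def)
  ultimately show ?thesis
    unfolding closed_proper_convex_def epi by simp
qed

section \<open>The weighted inner product and the proximal map\<close>

lemma is_inner_product_pos_def_matrix:
  assumes "pos_def_matrix D"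
  shows "is_inner_product (\<lambda>x y. x \<bullet> (D *v y))"
  unfolding is_inner_product_def
proof (intro conjI allI impI)
  show "linear (\<lambda>x. x \<bullet> (D *v y))" for y
    by (rule bounded_linear.linear[OF bounded_linear_inner_left])
  show "x \<bullet> (D *v y) = y \<bullet> (D *v x)" for x y
    by (rule pos_def_matrix_inner_commute[OF assms])
  show "0 < x \<bullet> (D *v x)" if "x \<noteq> 0" for x
    using assms that by (simp add: pos_def_matrix_def)
qed

lemma is_proximal_map_denoiser:
  assumes K: "pos_def_matrix K" and D: "pos_def_matrix D"
    and le: "\<And>x. x \<bullet> (K *v x) \<le> x \<bullet> (D *v x)"
  shows "is_proximal_map (\<lambda>x y. x \<bullet> (D *v y)) (\<lambda>x. ereal (regularizer K D x)) (denoiser K D)"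
proof -
  let ?B = "matrix_inv K"
  let ?A = "\<lambda>y. D *v (?B *v (D *v y))"
  let ?obj = "prox_objective (\<lambda>x y. x \<bullet> (D *v y)) (\<lambda>x. ereal (regularizer K D x))"
  note inv_K = matrix_inv_vector_mult[OF pos_def_matrix_invertible[OF K]]
  note inv_D = matrix_inv_vector_mult[OF pos_def_matrix_invertible[OF D]]
  note sym_K = pos_def_matrix_inner_commute[OF K]
  note sym_D = pos_def_matrix_inner_commute[OF D]
  \<comment> \<open>D K^{-1} D is \<open>K\<close> transported along the injective map K^{-1} D, and
    so inherits symmetry and positivity.\<close>
  have A_form: "x \<bullet> ?A y = (?B *v (D *v x)) \<bullet> (K *v (?B *v (D *v y)))" for x y
    unfolding inv_K using sym_D[of x "?B *v (D *v y)"] sym_K[of "?B *v (D *v x)" "?B *v (D *v y)"]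
    by (simp add: inv_K inner_commute)
  have sym_A: "x \<bullet> ?A y = y \<bullet> ?A x" for x y
    unfolding A_form by (rule sym_K)
  have pos_A: "0 < x \<bullet> ?A x" if "x \<noteq> 0" for x
  proof -
    have "?B *v (D *v x) \<noteq> 0"
      using that by (metis inv_K(1) inv_D(2) matrix_vector_mult_0_right)
    then show ?thesis unfolding A_form using K by (simp add: pos_def_matrix_def)
  qed
  \<comment> \<open>The term y.Dy / 2 from the squared norm cancels against the one in the
    regularizer, leaving \<open>?A\<close> as the only quadratic part in \<open>y\<close>.\<close>
  have obj: "?obj x y = ereal (1/2 * (x \<bullet> (D *v x)) - y \<bullet> (D *v x) + 1/2 * (y \<bullet> ?A y))" for x y
  proof -
    have "(ip_norm (\<lambda>x y. x \<bullet> (D *v y)) (y - x))\<^sup>2 = (y - x) \<bullet> (D *v (y - x))"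
      unfolding ip_norm_def by (rule real_sqrt_pow2[OF pos_def_matrix_nonneg[OF D]])
    moreover have "(y - x) \<bullet> (D *v (y - x)) = y \<bullet> (D *v y) - 2 * (y \<bullet> (D *v x)) + x \<bullet> (D *v x)"
      by (simp add: matrix_vector_mult_diff_distrib inner_diff_left inner_diff_right sym_D[of x y])
    moreover have "regularizer K D y = 1/2 * (y \<bullet> ?A y - y \<bullet> (D *v y))"
      unfolding regularizer_def
      by (simp add: matrix_vector_mul_assoc[symmetric] matrix_vector_mult_diff_rdistrib
          matrix_vector_mult_diff_distrib inner_diff_right)
    ultimately show ?thesis
      unfolding prox_objective_def by (simp add: algebra_simps)
  qed
  \<comment> \<open>Since \<open>?A z = D *v x\<close>, the linear term is y.Az and the square can
    be completed around \<open>z\<close>. Strict inequality gives uniqueness of the minimizer as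
    well.\<close>
  have less: "?obj x (denoiser K D x) < ?obj x y" if "y \<noteq> denoiser K D x" for x y
  proof -
    define z where "z = denoiser K D x"
    have "D *v z = K *v x"
      unfolding z_def denoiser_def matrix_vector_mul_assoc[symmetric] by (rule inv_D)
    then have "?A z = D *v x" by (simp add: inv_K)
    then have "(y - z) \<bullet> ?A (y - z) = y \<bullet> ?A y - 2 * (y \<bullet> (D *v x)) + z \<bullet> (D *v x)"
      using sym_A[of z y]
      by (simp add: matrix_vector_mult_diff_distrib inner_diff_left inner_diff_right)
    moreover have "0 < (y - z) \<bullet> ?A (y - z)"
      using that by (intro pos_A) (simp add: z_def)
    ultimately show ?thesis
      using \<open>?A z = D *v x\<close> unfolding obj z_def[symmetric] by simp
  qed
  have "{y. is_arg_min (?obj x) (\<lambda>_. True) y} = {denoiser K D x}" for x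
  proof (intro equalityI subsetI)
    fix y assume "y \<in> {y. is_arg_min (?obj x) (\<lambda>_. True) y}"
    then show "y \<in> {denoiser K D x}" using less[of y x] by (auto simp: is_arg_min_def)
  next
    fix y assume "y \<in> {denoiser K D x}"
    moreover have "\<not> ?obj x y < ?obj x (denoiser K D x)" for y
      using less[of y x] by (cases "y = denoiser K D x") (auto dest: less_asym)
    ultimately show "y \<in> {y. is_arg_min (?obj x) (\<lambda>_. True) y}" by (simp add: is_arg_min_def)
  qed
  then show ?thesis
    unfolding is_proximal_map_def
    using is_inner_product_pos_def_matrix[OF D] closed_proper_convex_real[OF convex_on_regularizer[OF K D le]]
    by blast
qed

section \<open>The normalization matrix\<close>

lemma normalization_matrix_mult_vec:
  "(normalization_matrix K *v x) $ i = (\<Sum>j\<in>UNIV. K $ i $ j) * x $ i"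
  by (simp add: normalization_matrix_def matrix_vector_mult_def if_distrib[of "\<lambda>y. y * _"] cong: if_cong)

lemma normalization_matrix_form:
  "x \<bullet> (normalization_matrix K *v x) = (\<Sum>i\<in>UNIV. \<Sum>j\<in>UNIV. K $ i $ j * (x $ i)\<^sup>2)"
  unfolding inner_vec_def normalization_matrix_mult_vec
  by (simp add: sum_distrib_left sum_distrib_right power2_eq_square mult_ac)

lemma pos_def_matrix_diag_pos:
  assumes "pos_def_matrix K"
  shows "0 < K $ i $ i"
proof -
  have "0 < axis i 1 \<bullet> (K *v axis i 1)"
    using assms by (simp add: pos_def_matrix_def axis_eq_0_iff)
  then show ?thesis by (simp add: inner_axis' matrix_vector_mul_component column_def matrix_vector_mult_basis)
qed

lemma pos_def_normalization_matrix:
  assumes K: "pos_def_matrix K" and nonneg: "\<And>i j. 0 \<le> K $ i $ j"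
  shows "pos_def_matrix (normalization_matrix K)"
proof -
  \<comment> \<open>Each row sum contains a positive diagonal entry of \<open>K\<close> and
    otherwise nonnegative terms.\<close>
  have row: "0 < (\<Sum>j\<in>UNIV. K $ i $ j)" for i
    using pos_def_matrix_diag_pos[OF K] nonneg by (intro sum_pos2[of UNIV i]) auto
  have "0 < x \<bullet> (normalization_matrix K *v x)" if x: "x \<noteq> 0" for x
  proof -
    obtain k where k: "x $ k \<noteq> 0" using x by (auto simp: vec_eq_iff)
    have "0 < (\<Sum>i\<in>UNIV. (\<Sum>j\<in>UNIV. K $ i $ j) * (x $ i)\<^sup>2)"
      using k by (intro sum_pos2[of UNIV k] mult_pos_pos mult_nonneg_nonneg less_imp_le[OF row] row) auto
    then show ?thesis unfolding normalization_matrix_form by (simp add: sum_distrib_right)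
  qed
  moreover have "transpose (normalization_matrix K) = normalization_matrix K"
    by (auto simp: transpose_def normalization_matrix_def vec_eq_iff)
  ultimately show ?thesis by (simp add: pos_def_matrix_def)
qed

lemma kernel_form_le_normalization_form:
  fixes K :: "real ^ 'n ^ 'n"
  assumes sym: "transpose K = K" and nonneg: "\<And>i j. 0 \<le> K $ i $ j"
  shows "x \<bullet> (K *v x) \<le> x \<bullet> (normalization_matrix K *v x)"
proof -
  have K_sym: "K $ i $ j = K $ j $ i" for i j
    using sym by (metis transpose_def vec_lambda_beta)
  have row: "(\<Sum>i\<in>UNIV. \<Sum>j\<in>UNIV. K $ i $ j * (x $ i)\<^sup>2) = (\<Sum>i\<in>UNIV. \<Sum>j\<in>UNIV. K $ i $ j * (x $ j)\<^sup>2)"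
    by (subst sum.swap) (intro sum.cong refl arg_cong2[where f = "(*)"] K_sym)
  \<comment> \<open>This sum of weighted squared differences is twice the Laplacian form x.(D - K)x;
    by \<open>row\<close> both of its square terms equal x.Dx.\<close>
  have "0 \<le> (\<Sum>i\<in>UNIV. \<Sum>j\<in>UNIV. K $ i $ j * (x $ i - x $ j)\<^sup>2)"
    by (intro sum_nonneg mult_nonneg_nonneg nonneg) simp
  also have "\<dots> = (\<Sum>i\<in>UNIV. \<Sum>j\<in>UNIV. K $ i $ j * (x $ i)\<^sup>2) + (\<Sum>i\<in>UNIV. \<Sum>j\<in>UNIV. K $ i $ j * (x $ j)\<^sup>2)
      - 2 * (\<Sum>i\<in>UNIV. \<Sum>j\<in>UNIV. x $ i * (K $ i $ j * x $ j))"
    by (simp add: sum_distrib_left sum.distrib[symmetric] sum_subtractf[symmetric] power2_diff algebra_simps)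
  also have "(\<Sum>i\<in>UNIV. \<Sum>j\<in>UNIV. x $ i * (K $ i $ j * x $ j)) = x \<bullet> (K *v x)"
    unfolding inner_vec_def matrix_vector_mult_def by (simp add: sum_distrib_left)
  finally show ?thesis unfolding normalization_matrix_form row[symmetric] by linarith
qed

theorem mainTheorem6:
  fixes \<Omega> :: "(int ^ 2) set"
    and patch :: "int ^ 2 \<Rightarrow> real ^ 'p"
    and Ns c :: real
    and Q :: "real ^ 'p ^ 'p"
    and \<xi> :: "'n::finite \<Rightarrow> (real ^ 2) \<times> (real ^ 'p)"
    and K D :: "real ^ 'n ^ 'n"
  assumes "finite \<Omega>"
    and "card \<Omega> = CARD('n)"
    and "Ns > 0"
    and "c > 0"
    and "pos_def_matrix Q"
    and "bij_betw \<xi> UNIV (feature patch ` \<Omega>)"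
    and "K = kernel_matrix (nlm_kernel Ns c Q) \<xi>"
    and "D = normalization_matrix K"
  shows "pos_def_matrix K \<and>
         invertible D \<and>
         convex_on UNIV (regularizer K D) \<and>
         is_proximal_map (\<lambda>x y. x \<bullet> (D *v y)) (\<lambda>x. ereal (regularizer K D x)) (denoiser K D)"
proof -
  \<comment> \<open>A real position determines its integer pixel and therefore the whole feature,
    and \<open>\<xi>\<close> lists each feature once.\<close>
  have inj: "inj (fst \<circ> \<xi>)"
  proof (rule injI)
    fix i j assume eq: "(fst \<circ> \<xi>) i = (fst \<circ> \<xi>) j"
    have "\<xi> i \<in> feature patch ` \<Omega>" "\<xi> j \<in> feature patch ` \<Omega>"
      using bij_betw_imp_surj_on[OF assms(6)] by blast+
    then obtain s t where st: "\<xi> i = feature patch s" "\<xi> j = feature patch t" by blast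
    with eq have "s = t" by (simp add: feature_def pixel_pos_def vec_eq_iff)
    with st show "i = j" using bij_betw_imp_inj_on[OF assms(6)] by (simp add: inj_def)
  qed
  have K: "pos_def_matrix K"
    unfolding assms(7) by (rule pos_def_matrix_nlm_kernel[OF assms(3-5) inj])
  have nonneg: "0 \<le> K $ i $ j" for i j
    using \<open>c > 0\<close>
    by (simp add: assms(7) kernel_matrix_def nlm_kernel_def hat_eq_hat1 hat1_nonneg gaussian_def)
  have D: "pos_def_matrix D"
    unfolding assms(8) by (rule pos_def_normalization_matrix[OF K nonneg])
  have le: "x \<bullet> (K *v x) \<le> x \<bullet> (D *v x)" for x
    unfolding assms(8) using K nonneg
    by (intro kernel_form_le_normalization_form) (simp_all add: pos_def_matrix_def)
  show ?thesis
    by (intro conjI K pos_def_matrix_invertible[OF D] convex_on_regularizer[OF K D le]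
        is_proximal_map_denoiser[OF K D le])
qed

end
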